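(* (a) For every $E\in\mathcal E$, $\xi\in\mathfrak S_3^{\nu}$ and $X\in\mathcal M$, $(E^{\xi})^{X}=(E^{X})^{\xi}$. (b) Let $B\in\mathrm{M}_3(\mathbb{R})$ be a cluster-cyclic skew-symmetrizable matrix, let $\mathbf w_0,\mathbf w_1\in\mathcal T$ each lie in a branch, and let $\xi\in\mathfrak S_3^{\nu}$ be the unique element with $E^{\mathbf w_1}=(E^{\mathbf w_0})^{\xi}$. Then $E^{\mathbf w_1X}=(E^{\mathbf w_0X})^{\xi}$ for all $X\in\mathcal M$. Moreover, writing $\xi=\lambda\sigma$ with $\lambda\in\{\mathrm{id},\nu\}$ and $\sigma\in\mathfrak S_3$, for every $\mathbf u\in\mathcal T\setminus\mathcal T^{\ge[K(\mathbf w_1)]}$ one has $E^{\mathbf w_1\mathbf u}=(E^{\mathbf w_0(\sigma\mathbf u)})^{\xi}$, where $\sigma[k_1,\dots,k_r]=[\sigma(k_1),\dots,\sigma(k_r)]$.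
   Context: A matrix $B=(b_{ij})\in\mathrm{M}_3(\mathbb{R})$ is skew-symmetrizable if $DB$ is skew-symmetric for some positive diagonal $D$. Notation: $[a]_+=\max(a,0)$, entrywise; $J_k$ diagonal with $k$th entry $-1$, others $1$; $A^{\bullet k}$ (resp. $A^{k\bullet}$) keeps only the $k$th column (resp. row) of $A$. Mutation: $\mu_k(B)=(J_k+[-B]_+^{\bullet k})B(J_k+[B]_+^{k\bullet})$. $\mathcal T$: reduced sequences $\mathbf w=[k_1,\dots,k_r]$ ($k_i\in\{1,2,3\}$, $k_i\ne k_{i+1}$), including $\emptyset$; $\mathbf w[k]$ appends $k$ if $\mathbf w=\emptyset$ or $k\ne k_r$, deletes the last entry if $k=k_r$; for $\mathbf u=[l_1,\dots,l_s]$, $\mathbf w\mathbf u=\mathbf w[l_1][l_2]\cdots[l_s]$. $\mathcal T^{\ge\mathbf v}$ is the set of sequences having $\mathbf v$ as initial segment (so $\mathcal T^{\ge[j]}$ consists of sequences starting with $j$). $B^{\mathbf w}=\mu_{k_r}\cdots\mu_{k_1}(B)=(b^{\mathbf w}_{ij})$. $C^\emptyset=I$, $C^{\mathbf w[k]}=C^{\mathbf w}J_k+C^{\mathbf w}[B^{\mathbf w}]_+^{k\bullet}+[-C^{\mathbf w}]_+^{\bullet k}B^{\mathbf w}$, columns $\mathbf c_i^{\mathbf w}$. $B$ is cyclic if $\mathrm{sign}(B)=\pm\begin{pmatrix}0&-1&1\\1&0&-1\\-1&1&0\end{pmatrix}$ entrywise; cluster-cyclic if all $B^{\mathbf w}$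 are cyclic. For cluster-cyclic $B$ all $\mathbf c_i^{\mathbf w}$ are nonzero and componentwise $\ge0$ or $\le 0$, with tropical signs $\varepsilon_i^{\mathbf w}\in\{\pm1\}$, $\varepsilon_i^{\mathbf w}\mathbf c_i^{\mathbf w}\ge\mathbf 0$. For $\mathbf w\ne\emptyset$ with last index $k$ there is a unique $s\ne k$ with $\varepsilon_s^{\mathbf w}\mathrm{sign}(b^{\mathbf w}_{ks})=-1$ and $\varepsilon_k^{\mathbf w}\ne\varepsilon_s^{\mathbf w}$; $t$ is the third index; $K(\mathbf w)=k$, $S(\mathbf w)=s$, $T(\mathbf w)=t$. The free monoid $\mathcal M$ on letters $S,T$ acts on the right on $\mathcal T\setminus\{\emptyset\}$ by $\mathbf wS=\mathbf w[S(\mathbf w)]$, $\mathbf wT=\mathbf w[T(\mathbf w)]$; every $\mathbf w\ne\emptyset$ is uniquely $[i]X$, $X\in\mathcal M$, and $\mathbf w$ lies in a branch if $T$ occurs in $X$. Put $E^{\mathbf w}=(\varepsilon_1^{\mathbf w},\varepsilon_2^{\mathbf w},\varepsilon_3^{\mathbf w};K(\mathbf w))$. $\mathcal E$ is the set of twelve tuples $(\varepsilon_1,\varepsilon_2,\varepsilon_3;k)$, $\varepsilon_j\in\{\pm1\}$, $k\in\{1,2,3\}$, with exactly one $j$ such that $\varepsilon_j\ne\varepsilon_k$ (for $\mathbf w$ in a branch, $E^{\mathbf w}\in\mathcal E$). On $\mathcal E$: $K(E)=k$, $S(E)$ = index $j\ne k$ with $\varepsilon_j\ne\varepsilon_k$,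 $T(E)$ = index $j\ne k$ with $\varepsilon_j=\varepsilon_k$; $E^S$ negates positions $k$ and $S(E)$ and relabels $k$ by $S(E)$; $E^T$ negates position $T(E)$ and relabels $k$ by $T(E)$; this extends to a right action of $\mathcal M$ on $\mathcal E$ (and $E^{\mathbf wX}=(E^{\mathbf w})^X$ for $\mathbf w$ in a branch). $\mathfrak S_3$ acts on $\mathcal E$ on the right by $(\varepsilon_1,\varepsilon_2,\varepsilon_3;k)^{\sigma}=(\varepsilon_{\sigma(1)},\varepsilon_{\sigma(2)},\varepsilon_{\sigma(3)};\sigma^{-1}(k))$; $\nu$ acts by negating all three signs and keeping $k$; $\mathfrak S_3^{\nu}=\{\mathrm{id},\nu\}\times\mathfrak S_3$ acts by combining these (they commute), and it acts simply transitively on $\mathcal E$. *)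

theory Defs
  imports "HOL-Analysis.Analysis" "HOL-Library.Sublist"
begin

text \<open>
  The index set \<open>{1,2,3}\<close> is the three-element type \<^typ>\<open>3\<close>, whose elements are \<open>1\<close>, \<open>2\<close> and
  \<open>3\<close> (the last one being equal to \<open>0\<close>).
\<close>

definition skew_symmetrizable :: "real^3^3 \<Rightarrow> bool" where
  "skew_symmetrizable B \<longleftrightarrow>
    (\<exists>D :: real^3^3. (\<forall>i. D $ i $ i > 0) \<and> (\<forall>i j. i \<noteq> j \<longrightarrow> D $ i $ j = 0) \<and>
       transpose (D ** B) = - (D ** B))"

definition J_mat :: "3 \<Rightarrow> real^3^3" where
  "J_mat k = (\<chi> i j. if i = j then (if i = k then -1 else 1) else 0)"

definition pos_part :: "real^3^3 \<Rightarrow> real^3^3" where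
  "pos_part A = (\<chi> i j. max (A $ i $ j) 0)"

definition only_col :: "3 \<Rightarrow> real^3^3 \<Rightarrow> real^3^3" where
  "only_col k A = (\<chi> i j. if j = k then A $ i $ j else 0)"

definition only_row :: "3 \<Rightarrow> real^3^3 \<Rightarrow> real^3^3" where
  "only_row k A = (\<chi> i j. if i = k then A $ i $ j else 0)"

definition mutate :: "3 \<Rightarrow> real^3^3 \<Rightarrow> real^3^3" where
  "mutate k B =
    (J_mat k + only_col k (pos_part (- B))) ** B ** (J_mat k + only_row k (pos_part B))"

definition reduced_seqs :: "3 list set" where
  "reduced_seqs = {w. successively (\<noteq>) w}"

definition append_index :: "3 list \<Rightarrow> 3 \<Rightarrow> 3 list" where
  "append_index w k = (if w = [] \<or> k \<noteq> last w then w @ [k] else butlast w)"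

definition seq_mult :: "3 list \<Rightarrow> 3 list \<Rightarrow> 3 list" where
  "seq_mult w u = foldl append_index w u"

definition reduced_seqs_ge :: "3 list \<Rightarrow> 3 list set" where
  "reduced_seqs_ge v = {w \<in> reduced_seqs. prefix v w}"

definition B_mat :: "real^3^3 \<Rightarrow> 3 list \<Rightarrow> real^3^3" where
  "B_mat B w = foldl (\<lambda>A k. mutate k A) B w"

definition mutate_BC :: "(real^3^3) \<times> (real^3^3) \<Rightarrow> 3 \<Rightarrow> (real^3^3) \<times> (real^3^3)" where
  "mutate_BC = (\<lambda>(A, C) k.
     (mutate k A,
      C ** J_mat k + C ** only_row k (pos_part A) + only_col k (pos_part (- C)) ** A))"

definition C_mat :: "real^3^3 \<Rightarrow> 3 list \<Rightarrow> real^3^3" where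
  "C_mat B w = snd (foldl mutate_BC (B, mat 1) w)"

lemma C_mat_Nil: "C_mat B [] = mat 1"
  by (simp add: C_mat_def)

lemma foldl_mutate_BC: "foldl mutate_BC (B, mat 1) w = (B_mat B w, C_mat B w)"
proof -
  have "fst (foldl mutate_BC (B, mat 1) w) = B_mat B w"
    by (induction w rule: rev_induct) (auto simp: B_mat_def mutate_BC_def split_beta)
  then show ?thesis
    by (simp add: C_mat_def prod_eq_iff)
qed

lemma C_mat_snoc:
  "C_mat B (w @ [k]) =
     C_mat B w ** J_mat k + C_mat B w ** only_row k (pos_part (B_mat B w))
       + only_col k (pos_part (- C_mat B w)) ** B_mat B w"
proof -
  have "C_mat B (w @ [k]) = snd (mutate_BC (B_mat B w, C_mat B w) k)"
    by (simp add: C_mat_def [of B "w @ [k]"] foldl_mutate_BC)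
  then show ?thesis
    by (simp add: mutate_BC_def)
qed

definition sign_mat :: "real^3^3 \<Rightarrow> real^3^3" where
  "sign_mat B = (\<chi> i j. sgn (B $ i $ j))"

definition cyclic_mat :: "real^3^3 \<Rightarrow> bool" where
  "cyclic_mat B \<longleftrightarrow>
    (let P = vector [vector [ 0, -1,  1],
                     vector [ 1,  0, -1],
                     vector [-1,  1,  0]] in sign_mat B = P \<or> sign_mat B = - P)"

definition cluster_cyclic :: "real^3^3 \<Rightarrow> bool" where
  "cluster_cyclic B \<longleftrightarrow> (\<forall>w\<in>reduced_seqs. cyclic_mat (B_mat B w))"

text \<open>
  \<^const>\<open>C_mat\<close> is defined by recursion along the sequence, i.e. by the steps appending an
  index. The same formula holds when \<open>append_index\<close> deletes the last index, so it is the
  full recursion over \<open>append_index\<close>.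
\<close>

lemma mutate_row:
  assumes "A $ k $ k = 0"
  shows "mutate k A $ k $ j = - (A $ k $ j)"
proof -
  have "(J_mat k + only_col k (pos_part (- A))) $ k $ l = (if l = k then -1 else 0)" for l
    using assms by (auto simp: J_mat_def only_col_def pos_part_def)
  then have row: "((J_mat k + only_col k (pos_part (- A))) ** A) $ k $ l = - (A $ k $ l)" for l
    by (simp add: matrix_matrix_mult_def if_distrib [of "\<lambda>x. x * _"] cong: if_cong)
  have "mutate k A $ k $ j = (\<Sum>l\<in>UNIV. ((J_mat k + only_col k (pos_part (- A))) ** A) $ k $ l *
      (J_mat k + only_row k (pos_part A)) $ l $ j)"
    unfolding mutate_def by (subst matrix_matrix_mult_def) simp
  also have "\<dots> = (\<Sum>l\<in>UNIV. if l = j then - (A $ k $ j) else 0)"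
    unfolding row using assms
    by (intro sum.cong) (auto simp: J_mat_def only_row_def pos_part_def)
  finally show ?thesis
    by simp
qed

lemma mutate_BC_entry:
  assumes "A $ k $ k = 0"
  shows "snd (mutate_BC (A, C) k) $ i $ j =
     (if j = k then - (C $ i $ k)
      else C $ i $ j + C $ i $ k * max (A $ k $ j) 0 + max (- (C $ i $ k)) 0 * A $ k $ j)"
proof -
  have "(C ** J_mat k) $ i $ j = (\<Sum>l\<in>UNIV. if l = j then C $ i $ j * (if j = k then -1 else 1) else 0)"
    unfolding matrix_matrix_mult_def J_mat_def vec_lambda_beta by (intro sum.cong) auto
  moreover have "(C ** only_row k (pos_part A)) $ i $ j =
      (\<Sum>l\<in>UNIV. if l = k then C $ i $ k * max (A $ k $ j) 0 else 0)"
    unfolding matrix_matrix_mult_def only_row_def pos_part_def vec_lambda_beta by (intro sum.cong) auto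
  moreover have "(only_col k (pos_part (- C)) ** A) $ i $ j =
      (\<Sum>l\<in>UNIV. if l = k then max (- (C $ i $ k)) 0 * A $ k $ j else 0)"
    unfolding matrix_matrix_mult_def only_col_def pos_part_def vec_lambda_beta by (intro sum.cong) auto
  ultimately show ?thesis
    using assms by (simp add: mutate_BC_def)
qed

lemma C_step_involution:
  assumes "A $ k $ k = 0"
  shows "snd (mutate_BC (mutate_BC (A, C) k) k) = C"
proof -
  define C' where "C' = snd (mutate_BC (A, C) k)"
  have pair: "mutate_BC (A, C) k = (mutate k A, C')"
    by (simp add: C'_def mutate_BC_def)
  have "mutate k A $ k $ k = 0"
    using assms by (simp add: mutate_row)
  then have "snd (mutate_BC (mutate k A, C') k) $ i $ j = C $ i $ j" for i j
    using assms by (simp add: mutate_BC_entry mutate_row C'_def max_def algebra_simps)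
  then show ?thesis
    by (simp add: pair vec_eq_iff)
qed

lemma C_mat_append_index:
  assumes "cluster_cyclic B" "w \<in> reduced_seqs"
  shows "C_mat B (append_index w k) =
     C_mat B w ** J_mat k + C_mat B w ** only_row k (pos_part (B_mat B w))
       + only_col k (pos_part (- C_mat B w)) ** B_mat B w"
proof (cases "w = [] \<or> k \<noteq> last w")
  case True
  then show ?thesis
    by (simp add: append_index_def C_mat_snoc)
next
  case False
  then obtain v where w: "w = v @ [k]"
    by (metis append_butlast_last_id)
  have "v \<in> reduced_seqs"
    using assms(2) by (simp add: w reduced_seqs_def successively_append_iff)
  with assms(1) have "cyclic_mat (B_mat B v)"
    by (simp add: cluster_cyclic_def)
  then have "sgn (B_mat B v $ k $ k) = 0"
    using exhaust_3[of k]
    by (auto simp: cyclic_mat_def sign_mat_def Let_def vec_eq_iff forall_3)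
  then have z: "B_mat B v $ k $ k = 0"
    by (simp add: sgn_zero_iff)
  define A where "A = B_mat B v"
  have fw: "mutate_BC (A, C_mat B v) k = (B_mat B w, C_mat B w)"
    using foldl_mutate_BC[of B w] by (simp add: w foldl_mutate_BC[of B v] A_def)
  have "snd (mutate_BC (B_mat B w, C_mat B w) k) = C_mat B v"
    using C_step_involution[of A k "C_mat B v"] z by (simp add: fw A_def [symmetric])
  moreover have "append_index w k = v"
    by (simp add: append_index_def w)
  ultimately show ?thesis
    by (simp add: mutate_BC_def)
qed

text \<open>
  The descriptions below are meaningful only when the columns of \<^const>\<open>C_mat\<close> are
  nonzero and sign-coherent, as they are for a cluster-cyclic skew-symmetrizable \<open>B\<close>.
\<close>

definition trop_sign :: "real^3^3 \<Rightarrow> 3 list \<Rightarrow> 3 \<Rightarrow> int" where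
  "trop_sign B w i =
    (THE e. e \<in> {1, -1} \<and> (\<forall>j. 0 \<le> of_int e * column i (C_mat B w) $ j))"

definition K_seq :: "3 list \<Rightarrow> 3" where
  "K_seq w = last w"

definition S_seq :: "real^3^3 \<Rightarrow> 3 list \<Rightarrow> 3" where
  "S_seq B w =
    (THE s. s \<noteq> K_seq w \<and>
       of_int (trop_sign B w s) * sgn (B_mat B w $ K_seq w $ s) = -1 \<and>
       trop_sign B w (K_seq w) \<noteq> trop_sign B w s)"

definition T_seq :: "real^3^3 \<Rightarrow> 3 list \<Rightarrow> 3" where
  "T_seq B w = (THE t. t \<noteq> K_seq w \<and> t \<noteq> S_seq B w)"

text \<open>An element of the free monoid on \<open>S\<close> and \<open>T\<close> is a \<open>letter list\<close>, acting letter by letter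
  from left to right.\<close>

datatype letter = LS | LT

fun seq_letter :: "real^3^3 \<Rightarrow> 3 list \<Rightarrow> letter \<Rightarrow> 3 list" where
  "seq_letter B w LS = append_index w (S_seq B w)"
| "seq_letter B w LT = append_index w (T_seq B w)"

definition seq_act :: "real^3^3 \<Rightarrow> 3 list \<Rightarrow> letter list \<Rightarrow> 3 list" where
  "seq_act B w X = foldl (seq_letter B) w X"

definition in_branch :: "real^3^3 \<Rightarrow> 3 list \<Rightarrow> bool" where
  "in_branch B w \<longleftrightarrow> (\<exists>i X. w = seq_act B [i] X \<and> LT \<in> set X)"

text \<open>The tuple \<open>(e\<^sub>1, e\<^sub>2, e\<^sub>3; k)\<close> is the pair of the function \<open>j \<mapsto> e\<^sub>j\<close> and \<open>k\<close>.\<close>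

type_synonym sign_tuple = "(3 \<Rightarrow> int) \<times> 3"

definition E_seq :: "real^3^3 \<Rightarrow> 3 list \<Rightarrow> sign_tuple" where
  "E_seq B w = (\<lambda>i. trop_sign B w i, K_seq w)"

definition sign_tuples :: "sign_tuple set" where
  "sign_tuples = {(e, k). (\<forall>j. e j \<in> {1, -1}) \<and> (\<exists>!j. e j \<noteq> e k)}"

definition S_tup :: "sign_tuple \<Rightarrow> 3" where
  "S_tup = (\<lambda>(e, k). THE j. j \<noteq> k \<and> e j \<noteq> e k)"

definition T_tup :: "sign_tuple \<Rightarrow> 3" where
  "T_tup = (\<lambda>(e, k). THE j. j \<noteq> k \<and> e j = e k)"

fun tup_letter :: "sign_tuple \<Rightarrow> letter \<Rightarrow> sign_tuple" where
  "tup_letter (e, k) LS =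
    ((\<lambda>j. if j = k \<or> j = S_tup (e, k) then - e j else e j), S_tup (e, k))"
| "tup_letter (e, k) LT =
    ((\<lambda>j. if j = T_tup (e, k) then - e j else e j), T_tup (e, k))"

definition tup_act :: "sign_tuple \<Rightarrow> letter list \<Rightarrow> sign_tuple" where
  "tup_act E X = foldl tup_letter E X"

text \<open>An element of \<open>{id, \<nu>} \<times> \<SS>\<^sub>3\<close> is a pair consisting of the
  component in \<open>{id, \<nu>}\<close> and a permutation of the index set.\<close>

datatype nu_elt = Nu_id | Nu

definition S3_nu :: "(nu_elt \<times> (3 \<Rightarrow> 3)) set" where
  "S3_nu = UNIV \<times> {\<sigma>. \<sigma> permutes UNIV}"

fun nu_act :: "sign_tuple \<Rightarrow> nu_elt \<Rightarrow> sign_tuple" where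
  "nu_act E Nu_id = E"
| "nu_act (e, k) Nu = ((\<lambda>j. - e j), k)"

definition perm_act :: "sign_tuple \<Rightarrow> (3 \<Rightarrow> 3) \<Rightarrow> sign_tuple" where
  "perm_act = (\<lambda>(e, k) \<sigma>. ((\<lambda>j. e (\<sigma> j)), inv \<sigma> k))"

definition S3_nu_act :: "sign_tuple \<Rightarrow> nu_elt \<times> (3 \<Rightarrow> 3) \<Rightarrow> sign_tuple" where
  "S3_nu_act E = (\<lambda>(l, \<sigma>). perm_act (nu_act E l) \<sigma>)"

end

theory Submission imports Defs begin

text \<open>
  Statement (b) reduces to (a) once the recursion \<open>E\<^sup>w\<^sup>X = (E\<^sup>w)\<^sup>X\<close> is known, and (a) is
  a one-letter check. For the recursion, choose \<open>q\<close> with \<open>q\<^sub>i\<^sup>2 b\<^sub>i\<^sub>j = - q\<^sub>j\<^sup>2 b\<^sub>j\<^sub>i\<close>. Cluster-cyclicity forces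
  all symmetrized weights \<open>p\<^sub>i\<^sub>j = \<bar>b\<^sub>i\<^sub>j\<bar> q\<^sub>i / q\<^sub>j\<close> to be at least 2: otherwise alternating mutation at
  \<open>i\<close> and \<open>j\<close> would turn a weight negative. The weights being at least 2, the inequality
  \<open>\<bar>c\<^sub>k\<bar> / q\<^sub>k \<le> \<bar>c\<^sub>s\<bar> / q\<^sub>s\<close>, with \<open>k\<close> the last index and \<open>s\<close> the index \<open>S(w)\<close>, propagates along the
  sequence. A mutation at \<open>s\<close> adds \<open>\<bar>b\<^sub>s\<^sub>k\<bar> c\<^sub>s\<close> to the oppositely signed \<open>c\<^sub>k\<close>, which therefore changes
  sign, while a mutation at the third index only adds a column to another one of the same sign.
\<close>

section \<open>Three indices and the sign pattern of a cyclic matrix\<close>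

lemma three_cases:
  fixes j k s t :: 3
  assumes "k \<noteq> s" "k \<noteq> t" "s \<noteq> t"
  shows "j = k \<or> j = s \<or> j = t"
  using assms exhaust_3[of j] exhaust_3[of k] exhaust_3[of s] exhaust_3[of t] by auto

lemma third_index:
  fixes i j :: 3
  obtains k where "i \<noteq> k" "j \<noteq> k"
proof -
  have "(1::3) \<noteq> 2" "(1::3) \<noteq> 3" "(2::3) \<noteq> 3" by simp_all
  then have "\<exists>k. i \<noteq> k \<and> j \<noteq> k" by metis
  then show ?thesis using that by blast
qed

text \<open>The scalar \<open>e\<close> merges the two admissible patterns, so that a sign claim
  becomes a finite check over indices; in a product of two entries it cancels.\<close>

lemma cyclic_mat_sgn:
  assumes "cyclic_mat A"
  obtains e :: real where "e \<in> {1, -1}"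
    "\<And>i j. sgn (A $ i $ j) = e * (vector [vector [0, -1, 1], vector [1, 0, -1], vector [-1, 1, 0]] :: real^3^3) $ i $ j"
proof -
  define P where "P = (vector [vector [0, -1, 1], vector [1, 0, -1], vector [-1, 1, 0]] :: real^3^3)"
  from assms have "sign_mat A = P \<or> sign_mat A = - P"
    by (simp add: cyclic_mat_def Let_def P_def)
  then show ?thesis
  proof
    assume "sign_mat A = P"
    then have "sgn (A $ i $ j) = 1 * P $ i $ j" for i j
      by (auto simp: sign_mat_def vec_eq_iff)
    then show ?thesis
      using that[of 1] unfolding P_def by blast
  next
    assume "sign_mat A = - P"
    then have "sgn (A $ i $ j) = -1 * P $ i $ j" for i j
      by (auto simp: sign_mat_def vec_eq_iff)
    then show ?thesis
      using that[of "-1"] unfolding P_def by blast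
  qed
qed

lemma mult_neg_sgn: "(x::real) * y < 0 \<longleftrightarrow> sgn x * sgn y = -1"
  by (auto simp: sgn_if mult_less_0_iff)

lemma mult_pos_sgn: "(x::real) * y > 0 \<longleftrightarrow> sgn x * sgn y = 1"
  by (auto simp: sgn_if zero_less_mult_iff)

lemma cyclic_mat_diag:
  assumes "cyclic_mat A"
  shows "A $ i $ i = 0"
proof -
  obtain e :: real where e: "\<And>i j. sgn (A $ i $ j) = e * (vector [vector [0, -1, 1], vector [1, 0, -1], vector [-1, 1, 0]] :: real^3^3) $ i $ j"
    using cyclic_mat_sgn[OF assms] by metis
  have "sgn (A $ i $ i) = 0"
    using exhaust_3[of i] by (auto simp: e)
  then show ?thesis
    by (simp add: sgn_zero_iff)
qed

text \<open>All four facts are unchanged when the matrix is negated, so they hold for both patterns: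
  the signs orient the indices as a 3-cycle.\<close>

lemma cyclic_mat_signs:
  assumes "cyclic_mat A" "i \<noteq> j" "i \<noteq> k" "j \<noteq> k"
  shows "A $ i $ j \<noteq> 0" "A $ i $ j * A $ i $ k < 0" "A $ i $ j * A $ j $ i < 0" "A $ i $ j * A $ j $ k > 0"
proof -
  obtain e :: real where e: "e \<in> {1, -1}"
    "\<And>i j. sgn (A $ i $ j) = e * (vector [vector [0, -1, 1], vector [1, 0, -1], vector [-1, 1, 0]] :: real^3^3) $ i $ j"
    using cyclic_mat_sgn[OF assms(1)] by metis
  have "A $ i $ j \<noteq> 0 \<and> A $ i $ j * A $ i $ k < 0 \<and> A $ i $ j * A $ j $ i < 0 \<and> A $ i $ j * A $ j $ k > 0"
    unfolding mult_neg_sgn mult_pos_sgn sgn_zero_iff[of "A $ i $ j", symmetric] e(2)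
    using e(1) assms(2-4) exhaust_3[of i] exhaust_3[of j] exhaust_3[of k]
    by (elim disjE) auto
  then show "A $ i $ j \<noteq> 0" "A $ i $ j * A $ i $ k < 0" "A $ i $ j * A $ j $ i < 0" "A $ i $ j * A $ j $ k > 0"
    by auto
qed

section \<open>Entries, signs and absolute values under mutation\<close>

lemma mutate_entry:
  assumes "A $ k $ k = 0"
  shows "mutate k A $ i $ j =
    (if i = k \<or> j = k then - A $ i $ j
     else A $ i $ j + max (- A $ i $ k) 0 * A $ k $ j + A $ i $ k * max (A $ k $ j) 0)"
proof -
  have left: "((J_mat k + only_col k (pos_part (- A))) ** A) $ i $ l =
      (if i = k then - A $ k $ l else A $ i $ l + max (- A $ i $ k) 0 * A $ k $ l)" for l
  proof -
    have "((J_mat k + only_col k (pos_part (- A))) ** A) $ i $ l =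
        (\<Sum>m\<in>UNIV. (if m = i then (if i = k then -1 else 1) * A $ i $ l else 0) +
          (if m = k then max (- A $ i $ k) 0 * A $ k $ l else 0))"
      unfolding matrix_matrix_mult_def vec_lambda_beta
      by (intro sum.cong refl) (auto simp: J_mat_def only_col_def pos_part_def algebra_simps)
    then show ?thesis
      using assms by (simp add: sum.distrib)
  qed
  define L where "L = (J_mat k + only_col k (pos_part (- A))) ** A"
  have "mutate k A $ i $ j =
      (\<Sum>m\<in>UNIV. (if m = j then L $ i $ j * (if j = k then -1 else 1) else 0) +
        (if m = k then L $ i $ k * max (A $ k $ j) 0 else 0))"
    unfolding mutate_def L_def [symmetric] matrix_matrix_mult_def [of L] vec_lambda_beta
    by (intro sum.cong refl) (auto simp: J_mat_def only_row_def pos_part_def algebra_simps)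
  also have "\<dots> = L $ i $ j * (if j = k then -1 else 1) + L $ i $ k * max (A $ k $ j) 0"
    by (simp add: sum.distrib)
  finally show ?thesis
    using assms by (auto simp: L_def left)
qed

text \<open>One off-diagonal entry fixes the sign pattern of a cyclic matrix, and mutation at
  \<open>k\<close> negates row \<open>k\<close>. Cyclicity before and after therefore forces the
  whole pattern to reverse.\<close>

lemma sgn_mutate:
  assumes "cyclic_mat A" "cyclic_mat (mutate k A)"
  shows "sgn (mutate k A $ i $ j) = - sgn (A $ i $ j)"
proof -
  define P where "P = (vector [vector [0, -1, 1], vector [1, 0, -1], vector [-1, 1, 0]] :: real^3^3)"
  obtain e where e: "e \<in> {1, -1}" "\<And>i j. sgn (A $ i $ j) = e * P $ i $ j"
    using cyclic_mat_sgn[OF assms(1)] unfolding P_def by metis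
  obtain e' where e': "e' \<in> {1, -1}" "\<And>i j. sgn (mutate k A $ i $ j) = e' * P $ i $ j"
    using cyclic_mat_sgn[OF assms(2)] unfolding P_def by metis
  obtain l where "k \<noteq> l"
    using third_index by metis
  then have "P $ k $ l \<noteq> 0"
    using exhaust_3[of k] exhaust_3[of l] by (auto simp: P_def)
  moreover have "sgn (mutate k A $ k $ l) = - sgn (A $ k $ l)"
    using cyclic_mat_diag[OF assms(1)] by (simp add: mutate_entry sgn_minus)
  ultimately have "e' = - e"
    unfolding e(2) e'(2) by (metis mult_minus_left mult_right_cancel)
  then show ?thesis
    by (simp add: e(2) e'(2))
qed

text \<open>The entries at \<open>i\<close>, \<open>k\<close> and at \<open>k\<close>,
  \<open>j\<close> have equal signs, so exactly one correction term survives, with sign opposite to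
  that of the entry at \<open>i\<close>, \<open>j\<close>. Since that entry reverses its sign, the
  correction outweighs it.\<close>

lemma abs_mutate:
  assumes "cyclic_mat A" "cyclic_mat (mutate k A)" "i \<noteq> j" "i \<noteq> k" "j \<noteq> k"
  shows "\<bar>mutate k A $ i $ j\<bar> = \<bar>A $ i $ k\<bar> * \<bar>A $ k $ j\<bar> - \<bar>A $ i $ j\<bar>"
proof -
  have m: "mutate k A $ i $ j = A $ i $ j + max (- A $ i $ k) 0 * A $ k $ j + A $ i $ k * max (A $ k $ j) 0"
    using cyclic_mat_diag[OF assms(1)] assms by (simp add: mutate_entry)
  have s: "sgn (mutate k A $ i $ j) = - sgn (A $ i $ j)"
    by (rule sgn_mutate[OF assms(1,2)])
  have "A $ i $ k * A $ k $ j > 0" "A $ i $ j * A $ i $ k < 0"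
    using cyclic_mat_signs[OF assms(1)] assms(3-5) by metis+
  then show ?thesis
    using s unfolding m
    by (auto simp: zero_less_mult_iff mult_less_0_iff sgn_if split: if_splits)
qed

section \<open>Symmetrizers and weights\<close>

text \<open>The squares of \<open>q\<close> form the diagonal of a symmetrizer; storing the roots
  keeps \<open>sqrt\<close> out of \<open>weight\<close>.\<close>

definition skew_weights :: "(3 \<Rightarrow> real) \<Rightarrow> real^3^3 \<Rightarrow> bool" where
  "skew_weights q A \<longleftrightarrow> (\<forall>i. q i > 0) \<and> (\<forall>i j. (q i)\<^sup>2 * A $ i $ j = - ((q j)\<^sup>2 * A $ j $ i))"

lemma skew_weightsI:
  "(\<And>i. q i > 0) \<Longrightarrow> (\<And>i j. (q i)\<^sup>2 * A $ i $ j = - ((q j)\<^sup>2 * A $ j $ i)) \<Longrightarrow> skew_weights q A"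
  unfolding skew_weights_def by blast

lemma skew_weights_pos: "skew_weights q A \<Longrightarrow> q i > 0"
  unfolding skew_weights_def by blast

lemma skew_weights_swap: "skew_weights q A \<Longrightarrow> (q i)\<^sup>2 * A $ i $ j = - ((q j)\<^sup>2 * A $ j $ i)"
  unfolding skew_weights_def by blast

lemma skew_symmetrizable_weights:
  assumes "skew_symmetrizable B"
  obtains q where "skew_weights q B"
proof -
  obtain D :: "real^3^3" where D: "\<And>i. D $ i $ i > 0" "\<And>i j. i \<noteq> j \<Longrightarrow> D $ i $ j = 0"
    "transpose (D ** B) = - (D ** B)"
    using assms by (auto simp: skew_symmetrizable_def)
  have e: "(D ** B) $ i $ j = D $ i $ i * B $ i $ j" for i j
  proof -
    have "(D ** B) $ i $ j = (\<Sum>l\<in>UNIV. D $ i $ l * B $ l $ j)"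
      by (simp add: matrix_matrix_mult_def)
    also have "\<dots> = (\<Sum>l\<in>UNIV. if l = i then D $ i $ i * B $ i $ j else 0)"
      by (intro sum.cong) (auto simp: D(2))
    finally show ?thesis by simp
  qed
  have "D $ j $ j * B $ j $ i = - (D $ i $ i * B $ i $ j)" for i j
  proof -
    have "transpose (D ** B) $ i $ j = (- (D ** B)) $ i $ j"
      by (simp only: D(3))
    then show ?thesis
      by (simp add: transpose_def e)
  qed
  then have "skew_weights (\<lambda>i. sqrt (D $ i $ i)) B"
    unfolding skew_weights_def real_sqrt_pow2[OF less_imp_le[OF D(1)]]
    using real_sqrt_gt_zero[OF D(1)] by blast
  then show ?thesis ..
qed

text \<open>Mutation keeps the symmetrizer: passing from an entry to the transposed one exchanges
  the two correction terms, up to sign and a common factor.\<close>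

lemma skew_weights_mutate:
  assumes "skew_weights q A"
  shows "skew_weights q (mutate k A)"
proof -
  have q: "q i > 0" and A: "(q i)\<^sup>2 * A $ i $ j = - ((q j)\<^sup>2 * A $ j $ i)" for i j
    using assms by (rule skew_weights_pos skew_weights_swap)+
  have z: "A $ k $ k = 0"
    using A[of k k] q[of k] by simp
  have s: "A $ j $ i = - ((q i)\<^sup>2 / (q j)\<^sup>2 * A $ i $ j)" for i j
    using A[of i j] q[of j] by (simp add: field_simps)
  have mx: "max (c * x) 0 = c * max x 0" if "c > 0" for c x :: real
    using that by (auto simp: max_def zero_le_mult_iff mult_le_0_iff)
  have "(q i)\<^sup>2 * mutate k A $ i $ j = - ((q j)\<^sup>2 * mutate k A $ j $ i)" for i j
  proof (cases "i = k \<or> j = k")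
    case True
    then show ?thesis using A[of i j] by (auto simp: mutate_entry[OF z])
  next
    case False
    have 1: "max (- A $ j $ k) 0 = (q k)\<^sup>2 / (q j)\<^sup>2 * max (A $ k $ j) 0"
      using s[where i=k and j=j] mx[of "(q k)\<^sup>2 / (q j)\<^sup>2"] q[of k] q[of j] by simp
    have 2: "max (A $ k $ i) 0 = (q i)\<^sup>2 / (q k)\<^sup>2 * max (- A $ i $ k) 0"
      using s[where i=i and j=k] mx[of "(q i)\<^sup>2 / (q k)\<^sup>2" "- A $ i $ k"] q[of k] q[of i] by simp
    have "(q i)\<^sup>2 * mutate k A $ i $ j = (q i)\<^sup>2 * A $ i $ j
        + (q i)\<^sup>2 * (max (- A $ i $ k) 0 * A $ k $ j + A $ i $ k * max (A $ k $ j) 0)"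
      using False by (simp add: mutate_entry[OF z] algebra_simps)
    moreover have "(q j)\<^sup>2 * mutate k A $ j $ i = (q j)\<^sup>2 * A $ j $ i
        - (q i)\<^sup>2 * (max (- A $ i $ k) 0 * A $ k $ j + A $ i $ k * max (A $ k $ j) 0)"
    proof -
      have "mutate k A $ j $ i = A $ j $ i + max (- A $ j $ k) 0 * A $ k $ i + A $ j $ k * max (A $ k $ i) 0"
        using False by (simp add: mutate_entry[OF z])
      also have "\<dots> = A $ j $ i + ((q k)\<^sup>2 / (q j)\<^sup>2 * max (A $ k $ j) 0) * (- ((q i)\<^sup>2 / (q k)\<^sup>2 * A $ i $ k))
          + (- ((q k)\<^sup>2 / (q j)\<^sup>2 * A $ k $ j)) * ((q i)\<^sup>2 / (q k)\<^sup>2 * max (- A $ i $ k) 0)"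
        by (simp only: 1 2 s[where i=i and j=k, symmetric] s[where i=k and j=j, symmetric])
      finally have m: "mutate k A $ j $ i = \<dots>" .
      show ?thesis
        unfolding m using q[of k] q[of j] by (simp add: field_simps)
    qed
    ultimately show ?thesis
      using A[of i j] by simp
  qed
  then show ?thesis
    using q by (intro skew_weightsI)
qed

lemma skew_weights_B_mat: "skew_weights q B \<Longrightarrow> skew_weights q (B_mat B w)"
  by (induction w rule: rev_induct) (auto simp: B_mat_def skew_weights_mutate)

text \<open>Symmetric in \<open>i\<close> and \<open>j\<close>, being \<open>sqrt \<bar>b\<^sub>i\<^sub>j b\<^sub>j\<^sub>i\<bar>\<close>.\<close>

definition weight :: "(3 \<Rightarrow> real) \<Rightarrow> real^3^3 \<Rightarrow> 3 \<Rightarrow> 3 \<Rightarrow> real" where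
  "weight q A i j = \<bar>A $ i $ j\<bar> * q i / q j"

lemma weight_sym:
  assumes "skew_weights q A"
  shows "weight q A i j = weight q A j i"
proof -
  have q: "q i > 0" "q j > 0" and A: "(q i)\<^sup>2 * A $ i $ j = - ((q j)\<^sup>2 * A $ j $ i)"
    using assms by (rule skew_weights_pos skew_weights_swap)+
  have "(q i)\<^sup>2 * \<bar>A $ i $ j\<bar> = \<bar>(q i)\<^sup>2 * A $ i $ j\<bar>"
    by (simp add: abs_mult)
  also have "\<dots> = (q j)\<^sup>2 * \<bar>A $ j $ i\<bar>"
    by (simp add: A abs_mult)
  finally show ?thesis
    using q by (simp add: weight_def field_simps power2_eq_square)
qed

lemma weight_pos:
  assumes "skew_weights q A" "cyclic_mat A" "i \<noteq> j"
  shows "weight q A i j > 0"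
proof -
  obtain k where "i \<noteq> k" "j \<noteq> k" by (rule third_index)
  then have "A $ i $ j \<noteq> 0"
    using cyclic_mat_signs(1)[OF assms(2,3)] by blast
  then show ?thesis
    using skew_weights_pos[OF assms(1)] by (simp add: weight_def)
qed

text \<open>The factors \<open>q k\<close> cancel in the product, which turns
  \<open>abs_mutate\<close> into a recurrence in the weights alone.\<close>

lemma weight_mutate:
  assumes "skew_weights q A" "cyclic_mat A" "cyclic_mat (mutate k A)" "i \<noteq> j" "i \<noteq> k" "j \<noteq> k"
  shows "weight q (mutate k A) i j = weight q A i k * weight q A k j - weight q A i j"
proof -
  have "q k > 0" "q j > 0"
    using assms(1) by (rule skew_weights_pos)+
  then show ?thesis
    unfolding weight_def abs_mutate[OF assms(2-6)] by (simp add: field_simps)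
qed

lemma weight_mutate_same:
  assumes "cyclic_mat A"
  shows "weight q (mutate k A) i k = weight q A i k" "weight q (mutate k A) k i = weight q A k i"
  using cyclic_mat_diag[OF assms] by (simp_all add: weight_def mutate_entry)

section \<open>The lower bound 2 for the weights\<close>

lemma B_mat_append: "B_mat B (v @ w) = B_mat (B_mat B v) w"
  by (simp add: B_mat_def)

fun alternating :: "nat \<Rightarrow> 'a \<Rightarrow> 'a \<Rightarrow> 'a list" where
  "alternating 0 i j = []"
| "alternating (Suc n) i j = i # alternating n j i"

lemma successively_alternating: "i \<noteq> j \<Longrightarrow> successively (\<noteq>) (alternating n i j)"
proof (induction n arbitrary: i j)
  case (Suc n)
  then show ?case by (cases n) (auto simp: successively_Cons)
qed simp

text \<open>Under alternating mutation at \<open>i\<close> and \<open>j\<close> the weights towards the third index obey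
  \<open>x\<^sub>n\<^sub>+\<^sub>2 = p x\<^sub>n\<^sub>+\<^sub>1 - x\<^sub>n\<close>, and their ratio \<open>r\<close> drops by \<open>r + 1/r - p \<ge> 2 - p\<close> at each step.\<close>

lemma weight_ratio_ge:
  assumes "skew_weights q A" "\<And>m. cyclic_mat (B_mat A (alternating m i j))"
    and "i \<noteq> j" "i \<noteq> t" "j \<noteq> t"
  shows "weight q A t i / weight q A t j \<ge> real n * (2 - weight q A i j)"
  using assms
proof (induction n arbitrary: A i j)
  case 0
  have "cyclic_mat A" using 0(2)[of 0] by (simp add: B_mat_def)
  then show ?case
    using weight_pos[OF 0(1)] 0(4,5) by (simp add: less_imp_le)
next
  case (Suc n)
  define A' where "A' = mutate i A"
  have cA: "cyclic_mat A" using Suc.prems(2)[of 0] by (simp add: B_mat_def)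
  have cA': "cyclic_mat (B_mat A' (alternating m j i))" for m
    using Suc.prems(2)[of "Suc m"] by (simp add: B_mat_def A'_def)
  then have cA'0: "cyclic_mat A'" using cA'[of 0] by (simp add: B_mat_def)
  have skA': "skew_weights q A'"
    using Suc.prems(1) by (simp add: A'_def skew_weights_mutate)
  define p x y where "p = weight q A i j" and "x = weight q A t i" and "y = weight q A t j"
  have pos: "p > 0" "x > 0" "y > 0"
    unfolding p_def x_def y_def using weight_pos[OF Suc.prems(1) cA] Suc.prems by auto
  have "weight q A' t j / weight q A' t i \<ge> real n * (2 - weight q A' j i)"
    using Suc.IH[OF skA' cA'] Suc.prems by metis
  moreover have "weight q A' t j = x * p - y"
    using weight_mutate[OF Suc.prems(1) cA cA'0[unfolded A'_def]] Suc.prems(3-5)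
    by (simp add: A'_def p_def x_def y_def)
  moreover have "weight q A' t i = x" "weight q A' j i = p"
    by (simp_all add: A'_def weight_mutate_same[OF cA] x_def p_def weight_sym[OF Suc.prems(1), of j i])
  \<comment> \<open>The ratio after the mutation is \<open>p - y / x\<close>; together with
    \<open>x / y + y / x \<ge> 2\<close> this raises the bound on \<open>x / y\<close> by a further
    \<open>2 - p\<close>.\<close>
  ultimately have "real n * (2 - p) \<le> p - y / x"
    using pos by (simp add: field_simps)
  moreover have "x / y + y / x \<ge> 2"
  proof -
    have "(x - y)\<^sup>2 \<ge> 0" by simp
    then have "2 * (x * y) \<le> x * x + y * y"
      by (simp add: power2_eq_square algebra_simps)
    then show ?thesis using pos by (simp add: field_simps)
  qed
  ultimately show ?case
    by (simp add: p_def [symmetric] x_def [symmetric] y_def [symmetric] algebra_simps)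
qed

text \<open>Below 2, the factor \<open>2 - weight q A i j\<close> would be positive, and
  \<open>weight_ratio_ge\<close>, valid for every \<open>n\<close>, would bound one fixed ratio
  below by arbitrarily large numbers.\<close>

lemma weight_ge_2_alternating:
  assumes "skew_weights q A" "\<And>m. cyclic_mat (B_mat A (alternating m i j))" "i \<noteq> j"
  shows "weight q A i j \<ge> 2"
proof (rule ccontr)
  assume a: "\<not> ?thesis"
  obtain t where t: "i \<noteq> t" "j \<noteq> t" by (rule third_index)
  obtain n where "real n * (2 - weight q A i j) > weight q A t i / weight q A t j"
    using a reals_Archimedean3[of "2 - weight q A i j"] by auto
  with weight_ratio_ge[OF assms t, of n] show False by simp
qed

text \<open>The alternating sequence has to start away from the last index of \<open>w\<close> for
  the concatenation to be reduced. At least one of \<open>i\<close> and \<open>j\<close> can be the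
  start, and \<open>weight\<close> is symmetric.\<close>

lemma cluster_cyclic_weight_ge_2:
  assumes "cluster_cyclic B" "skew_weights q B" "w \<in> reduced_seqs" "i \<noteq> j"
  shows "weight q (B_mat B w) i j \<ge> 2"
proof -
  have *: "weight q (B_mat B w) a b \<ge> 2" if "a \<noteq> b" "w = [] \<or> last w \<noteq> a" for a b
  proof (rule weight_ge_2_alternating)
    show "skew_weights q (B_mat B w)" by (rule skew_weights_B_mat[OF assms(2)])
    fix m
    have "w @ alternating m a b \<in> reduced_seqs"
      using that assms(3) successively_alternating[OF that(1), of m]
      by (cases m) (auto simp: reduced_seqs_def successively_append_iff)
    then show "cyclic_mat (B_mat (B_mat B w) (alternating m a b))"
      using assms(1) by (simp add: cluster_cyclic_def B_mat_append [symmetric])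
  qed (use that in auto)
  show ?thesis
  proof (cases "w = [] \<or> last w \<noteq> i")
    case True
    then show ?thesis using * assms(4) by blast
  next
    case False
    then have "weight q (B_mat B w) j i \<ge> 2" using * assms(4) by metis
    then show ?thesis by (simp add: weight_sym[OF skew_weights_B_mat[OF assms(2)], of _ i])
  qed
qed


section \<open>Sign-coherent C-matrices under one mutation\<close>

text \<open>Because no column vanishes, the signs \<open>e\<close> are determined by
  \<open>C\<close>.\<close>

definition coherent :: "real^3^3 \<Rightarrow> (3 \<Rightarrow> int) \<Rightarrow> bool" where
  "coherent C e \<longleftrightarrow>
    (\<forall>i. e i \<in> {1, -1}) \<and> (\<forall>i j. 0 \<le> real_of_int (e i) * C $ j $ i) \<and> (\<forall>i. \<exists>j. C $ j $ i \<noteq> 0)"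

text \<open>The invariant carried along a sequence with last index \<open>k\<close>; \<open>s\<close> is the index \<open>S(w)\<close>.\<close>

definition dominated :: "(3 \<Rightarrow> real) \<Rightarrow> real^3^3 \<Rightarrow> real^3^3 \<Rightarrow> (3 \<Rightarrow> int) \<Rightarrow> 3 \<Rightarrow> 3 \<Rightarrow> bool" where
  "dominated q A C e k s \<longleftrightarrow>
    k \<noteq> s \<and> e s = - e k \<and> 0 < real_of_int (e k) * A $ k $ s \<and>
    (\<forall>j. \<bar>C $ j $ k\<bar> * q s \<le> \<bar>C $ j $ s\<bar> * q k)"

lemma abs_eq_sign_mult:
  fixes e :: int
  assumes "e \<in> {1, -1}" "0 \<le> real_of_int e * x"
  shows "\<bar>x\<bar> = real_of_int e * x"
  using assms by auto

text \<open>Since column \<open>k\<close> has sign \<open>e k\<close>, the two correction terms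
  combine into one: row \<open>k\<close> contributes its positive part for \<open>e k = 1\<close>
  and its negative part for \<open>e k = -1\<close>.\<close>

lemma mutate_BC_coherent:
  assumes "cyclic_mat A" "coherent C e"
  shows "snd (mutate_BC (A, C) k) $ i $ j =
    (if j = k then - C $ i $ k else C $ i $ j + C $ i $ k * max (real_of_int (e k) * A $ k $ j) 0)"
proof -
  have "e k \<in> {1, -1}" "0 \<le> real_of_int (e k) * C $ i $ k"
    using assms(2) by (auto simp: coherent_def)
  then show ?thesis
    using cyclic_mat_diag[OF assms(1)]
    by (auto simp: mutate_BC_entry max_def algebra_simps)
qed

text \<open>One positive entry fixes the orientation: after scaling by \<open>c\<close>, the
  positive entries run along the cycle \<open>k\<close>, \<open>s\<close>, \<open>t\<close>,
  \<open>k\<close>.\<close>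

lemma cyclic_mat_oriented:
  assumes "cyclic_mat A" "k \<noteq> s" "k \<noteq> t" "s \<noteq> t" "0 < c * A $ k $ s"
  shows "0 < c * A $ t $ k" "c * A $ s $ k < 0" "c * A $ k $ t < 0"
    "0 < c * A $ s $ t" "c * A $ t $ s < 0"
proof -
  have "A $ k $ s * A $ k $ t < 0" "A $ k $ s * A $ s $ k < 0" "A $ k $ s * A $ s $ t > 0"
    "A $ t $ k * A $ k $ s > 0" "A $ s $ t * A $ t $ s < 0"
    using cyclic_mat_signs[OF assms(1)] assms(2-4) by metis+
  then show "0 < c * A $ t $ k" "c * A $ s $ k < 0" "c * A $ k $ t < 0"
    "0 < c * A $ s $ t" "c * A $ t $ s < 0"
    using assms(5) by (auto simp: zero_less_mult_iff mult_less_0_iff)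
qed

text \<open>This step creates the invariant: column \<open>a\<close> gains a multiple of column
  \<open>t\<close>, of the same sign, so nothing cancels, and by the weight bound the gain alone
  suffices for \<open>dominated\<close>.\<close>

lemma mutate_same_sign_step:
  assumes cyc: "cyclic_mat A" "cyclic_mat (mutate t A)"
    and q: "skew_weights q A" and w: "weight q A t a \<ge> 2"
    and coh: "coherent C e"
    and a: "a \<noteq> t" "e a = e t" "0 < real_of_int (e t) * A $ t $ a"
  defines "e' \<equiv> \<lambda>j. if j = t then - e j else e j"
  shows "coherent (snd (mutate_BC (A, C) t)) e'"
    and "dominated q (mutate t A) (snd (mutate_BC (A, C) t)) e' t a"
proof -
  obtain c where c: "a \<noteq> c" "t \<noteq> c" by (rule third_index)
  define C' where "C' = snd (mutate_BC (A, C) t)"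
  note entry = mutate_BC_coherent[OF cyc(1) coh, of t, folded C'_def]
  have e: "e i \<in> {1, -1}" and nn: "0 \<le> real_of_int (e i) * C $ j $ i"
    and nz: "\<exists>j. C $ j $ i \<noteq> 0" for i j
    using coh by (auto simp: coherent_def)
  \<comment> \<open>The opposite orientation at \<open>c\<close> makes the positive part there
    vanish, so \<open>a\<close> is the only column changed besides \<open>t\<close>.\<close>
  have "real_of_int (e t) * A $ t $ c < 0"
    using cyclic_mat_oriented(3)[OF cyc(1) _ _ _ a(3)] a(1) c by metis
  then have C't: "C' $ j $ t = - C $ j $ t" and C'c: "C' $ j $ c = C $ j $ c"
    and C'a: "C' $ j $ a = C $ j $ a + C $ j $ t * (real_of_int (e t) * A $ t $ a)" for j
    using a c by (simp_all add: entry max_def)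
  define p where "p = real_of_int (e t) * A $ t $ a"
  have p: "p = \<bar>A $ t $ a\<bar>"
    using e[of t] a(3) by (auto simp: p_def)
  have pos: "q t > 0" "q a > 0" "p > 0"
    using q skew_weights_pos a(3) by (auto simp: p_def)
  have p2: "p * q t \<ge> 2 * q a"
    using w pos by (simp add: weight_def p [symmetric] field_simps)
  have ea: "real_of_int (e a) * C' $ j $ a = \<bar>C $ j $ a\<bar> + \<bar>C $ j $ t\<bar> * p" for j
    using abs_eq_sign_mult[OF e[of a] nn[of a j]] abs_eq_sign_mult[OF e[of t] nn[of t j]]
    by (simp add: C'a p_def [symmetric] a(2) algebra_simps)
  have e': "e' i \<in> {1, -1}" for i
    using e[of i] by (auto simp: e'_def)
  have ea0: "0 \<le> real_of_int (e a) * C' $ j $ a" for j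
    unfolding ea using pos by simp
  have nn': "0 \<le> real_of_int (e' i) * C' $ j $ i" for i j
    using three_cases[OF a(1) c(1) c(2), of i] ea0[of j] nn[of t j] nn[of c j] a(1) c
    by (auto simp: e'_def C't C'c)
  have abs_a: "\<bar>C' $ j $ a\<bar> = \<bar>C $ j $ a\<bar> + \<bar>C $ j $ t\<bar> * p" for j
    using abs_eq_sign_mult[OF e ea0] by (simp add: ea)
  have "\<exists>j. C' $ j $ a \<noteq> 0"
  proof -
    obtain j where "C $ j $ t \<noteq> 0" using nz by blast
    then have "\<bar>C' $ j $ a\<bar> > 0"
      unfolding abs_a using pos by (simp add: add_nonneg_pos)
    then show ?thesis by auto
  qed
  then have nz': "\<exists>j. C' $ j $ i \<noteq> 0" for i
    using three_cases[OF a(1) c(1) c(2), of i] nz[of t] nz[of c] by (auto simp: C't C'c)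
  show "coherent (snd (mutate_BC (A, C) t)) e'"
    unfolding coherent_def C'_def [symmetric] using e' nn' nz' by blast
  have "\<bar>C' $ j $ t\<bar> * q a \<le> \<bar>C' $ j $ a\<bar> * q t" for j
  proof -
    have "\<bar>C' $ j $ t\<bar> * q a \<le> \<bar>C $ j $ t\<bar> * (2 * q a)"
      using pos by (simp add: C't)
    also have "\<dots> \<le> \<bar>C $ j $ t\<bar> * (p * q t)"
      using p2 by (intro mult_left_mono) auto
    also have "\<dots> \<le> \<bar>C' $ j $ a\<bar> * q t"
      using pos by (simp add: abs_a algebra_simps)
    finally show ?thesis .
  qed
  moreover have "0 < real_of_int (e' t) * mutate t A $ t $ a"
    using a(3) by (simp add: mutate_entry[OF cyclic_mat_diag[OF cyc(1)]] e'_def)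
  ultimately show "dominated q (mutate t A) (snd (mutate_BC (A, C) t)) e' t a"
    unfolding dominated_def C'_def [symmetric] using a by (auto simp: e'_def)
qed

text \<open>Columns \<open>k\<close> and \<open>s\<close> have opposite signs, so cancellation has
  to be controlled. On the scale of \<open>q\<close>, the weight bound supplies two copies of column
  \<open>s\<close>, and by the invariant column \<open>k\<close> consumes at most one. The copy left
  over flips the sign and restores the invariant with \<open>k\<close> and \<open>s\<close>
  exchanged.\<close>

lemma mutate_opposite_sign_step:
  assumes cyc: "cyclic_mat A" "cyclic_mat (mutate s A)"
    and q: "skew_weights q A" and w: "weight q A s k \<ge> 2"
    and coh: "coherent C e" and dom: "dominated q A C e k s"
  defines "e' \<equiv> \<lambda>j. if j = k \<or> j = s then - e j else e j"
  shows "coherent (snd (mutate_BC (A, C) s)) e'"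
    and "dominated q (mutate s A) (snd (mutate_BC (A, C) s)) e' s k"
proof -
  have ks: "k \<noteq> s" "e s = - e k" "0 < real_of_int (e k) * A $ k $ s"
    and le: "\<bar>C $ j $ k\<bar> * q s \<le> \<bar>C $ j $ s\<bar> * q k" for j
    using dom by (auto simp: dominated_def)
  obtain t where t: "k \<noteq> t" "s \<noteq> t" by (rule third_index)
  define C' where "C' = snd (mutate_BC (A, C) s)"
  note entry = mutate_BC_coherent[OF cyc(1) coh, of s, folded C'_def]
  have e: "e i \<in> {1, -1}" and nn: "0 \<le> real_of_int (e i) * C $ j $ i"
    and nz: "\<exists>j. C $ j $ i \<noteq> 0" for i j
    using coh by (auto simp: coherent_def)
  define p where "p = real_of_int (e s) * A $ s $ k"
  have "p > 0" "real_of_int (e s) * A $ s $ t < 0"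
    using cyclic_mat_oriented(2,4)[OF cyc(1) ks(1) t ks(3)] by (auto simp: p_def ks(2))
  then have C's: "C' $ j $ s = - C $ j $ s" and C't: "C' $ j $ t = C $ j $ t"
    and C'k: "C' $ j $ k = C $ j $ k + C $ j $ s * p" for j
    using ks(1) t by (simp_all add: entry max_def p_def)
  have p: "p = \<bar>A $ s $ k\<bar>"
    using e[of s] \<open>p > 0\<close> by (auto simp: p_def)
  have pos: "q s > 0" "q k > 0"
    using q skew_weights_pos by auto
  have p2: "p * q s \<ge> 2 * q k"
    using w pos by (simp add: weight_def p [symmetric] field_simps)
  have ek: "real_of_int (e s) * C' $ j $ k = \<bar>C $ j $ s\<bar> * p - \<bar>C $ j $ k\<bar>" for j
    using abs_eq_sign_mult[OF e[of s] nn[of s j]] abs_eq_sign_mult[OF e[of k] nn[of k j]]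
    by (simp add: C'k ks(2) algebra_simps)
  \<comment> \<open>This estimate yields the new sign of column \<open>k\<close>, its nonvanishing
    and the new domination.\<close>
  have bound: "\<bar>C $ j $ s\<bar> * q k \<le> (real_of_int (e s) * C' $ j $ k) * q s" for j
  proof -
    have "\<bar>C $ j $ s\<bar> * (2 * q k) \<le> \<bar>C $ j $ s\<bar> * (p * q s)"
      using p2 by (intro mult_left_mono) auto
    with le[of j] show ?thesis
      unfolding ek by (simp add: algebra_simps)
  qed
  have ek0: "0 \<le> real_of_int (e s) * C' $ j $ k" for j
  proof -
    have "0 \<le> \<bar>C $ j $ s\<bar> * q k" using pos by simp
    with bound[of j] have "0 \<le> (real_of_int (e s) * C' $ j $ k) * q s" by linarith
    then show ?thesis using pos by (simp add: zero_le_mult_iff)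
  qed
  have abs_k: "\<bar>C' $ j $ k\<bar> = real_of_int (e s) * C' $ j $ k" for j
    by (rule abs_eq_sign_mult[OF e ek0])
  have e': "e' i \<in> {1, -1}" for i
    using e[of i] by (auto simp: e'_def)
  have nn': "0 \<le> real_of_int (e' i) * C' $ j $ i" for i j
    using three_cases[OF ks(1) t, of i] ek0[of j] nn[of s j] nn[of t j] ks t
    by (auto simp: e'_def C's C't)
  have "\<exists>j. C' $ j $ k \<noteq> 0"
  proof -
    obtain j where "C $ j $ s \<noteq> 0" using nz by blast
    then have "\<bar>C $ j $ s\<bar> * q k > 0" using pos by simp
    with bound[of j] have "C' $ j $ k \<noteq> 0" by auto
    then show ?thesis ..
  qed
  then have nz': "\<exists>j. C' $ j $ i \<noteq> 0" for i
    using three_cases[OF ks(1) t, of i] nz[of s] nz[of t] by (auto simp: C's C't)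
  show "coherent (snd (mutate_BC (A, C) s)) e'"
    unfolding coherent_def C'_def [symmetric] using e' nn' nz' by blast
  have "\<bar>C' $ j $ s\<bar> * q k \<le> \<bar>C' $ j $ k\<bar> * q s" for j
    using bound[of j] by (simp add: C's abs_k)
  moreover have "0 < real_of_int (e' s) * mutate s A $ s $ k"
    using \<open>p > 0\<close> by (simp add: mutate_entry[OF cyclic_mat_diag[OF cyc(1)]] e'_def p_def)
  ultimately show "dominated q (mutate s A) (snd (mutate_BC (A, C) s)) e' s k"
    unfolding dominated_def C'_def [symmetric] using ks by (auto simp: e'_def)
qed

section \<open>Signs and the indices K, S, T along a sequence\<close>

definition signed_seq :: "real^3^3 \<Rightarrow> (3 \<Rightarrow> real) \<Rightarrow> 3 list \<Rightarrow> (3 \<Rightarrow> int) \<Rightarrow> 3 \<Rightarrow> 3 \<Rightarrow> bool" where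
  "signed_seq B q w e k s \<longleftrightarrow>
    w \<in> reduced_seqs \<and> w \<noteq> [] \<and> last w = k \<and>
    coherent (C_mat B w) e \<and> dominated q (B_mat B w) (C_mat B w) e k s"

lemma B_C_mat_snoc:
  "B_mat B (w @ [k]) = mutate k (B_mat B w)"
  "C_mat B (w @ [k]) = snd (mutate_BC (B_mat B w, C_mat B w) k)"
  by (simp_all add: B_mat_def C_mat_snoc mutate_BC_def)

lemma reduced_seqs_snoc: "w \<in> reduced_seqs \<Longrightarrow> w = [] \<or> last w \<noteq> k \<Longrightarrow> w @ [k] \<in> reduced_seqs"
  by (auto simp: reduced_seqs_def successively_append_iff)

lemma signed_seq_same_sign_step:
  assumes B: "cluster_cyclic B" "skew_weights q B"
    and w: "w \<in> reduced_seqs" "w = [] \<or> last w \<noteq> t" and coh: "coherent (C_mat B w) e"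
    and a: "a \<noteq> t" "e a = e t" "0 < real_of_int (e t) * B_mat B w $ t $ a"
  shows "signed_seq B q (w @ [t]) (\<lambda>j. if j = t then - e j else e j) t a"
proof -
  have wt: "w @ [t] \<in> reduced_seqs" using w by (rule reduced_seqs_snoc)
  have cyc: "cyclic_mat (B_mat B w)" "cyclic_mat (mutate t (B_mat B w))"
    using B(1) w(1) wt by (auto simp: cluster_cyclic_def B_C_mat_snoc(1) [symmetric])
  show ?thesis
    using mutate_same_sign_step[OF cyc skew_weights_B_mat[OF B(2)]
        cluster_cyclic_weight_ge_2[OF B w(1) a(1)[symmetric]] coh a] wt
    by (simp add: signed_seq_def B_C_mat_snoc)
qed

lemma signed_seq_opposite_sign_step:
  assumes B: "cluster_cyclic B" "skew_weights q B" and w: "signed_seq B q w e k s"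
  shows "signed_seq B q (w @ [s]) (\<lambda>j. if j = k \<or> j = s then - e j else e j) s k"
proof -
  have w': "w \<in> reduced_seqs" "w \<noteq> []" "last w = k" "coherent (C_mat B w) e"
    "dominated q (B_mat B w) (C_mat B w) e k s"
    using w by (auto simp: signed_seq_def)
  have ks: "s \<noteq> k" using w'(5) by (auto simp: dominated_def)
  have wt: "w @ [s] \<in> reduced_seqs" using w' ks by (intro reduced_seqs_snoc) auto
  have cyc: "cyclic_mat (B_mat B w)" "cyclic_mat (mutate s (B_mat B w))"
    using B(1) w'(1) wt by (auto simp: cluster_cyclic_def B_C_mat_snoc(1) [symmetric])
  show ?thesis
    using mutate_opposite_sign_step[OF cyc skew_weights_B_mat[OF B(2)]
        cluster_cyclic_weight_ge_2[OF B w'(1) ks] w'(4,5)] wt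
    by (simp add: signed_seq_def B_C_mat_snoc)
qed

text \<open>At the empty sequence the columns are unit vectors, all of sign 1, so the first mutation
  is a same-sign step; \<open>a\<close> is the index whose entry in row \<open>i\<close> is
  positive.\<close>

lemma signed_seq_singleton:
  assumes B: "cluster_cyclic B" "skew_weights q B"
  obtains a where "signed_seq B q [i] (\<lambda>j. if j = i then - 1 else 1) i a"
proof -
  have cyc: "cyclic_mat B"
    using B(1)[unfolded cluster_cyclic_def, THEN bspec, of "[]"]
    by (simp add: reduced_seqs_def B_mat_def)
  obtain j k where jk: "i \<noteq> j" "i \<noteq> k" "j \<noteq> k"
    using third_index by metis
  have "B $ i $ j * B $ i $ k < 0"
    using cyclic_mat_signs(2)[OF cyc jk] .
  then obtain a where a: "a \<noteq> i" "B $ i $ a > 0"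
    using jk by (metis mult_less_0_iff)
  have coh: "coherent (C_mat B []) (\<lambda>_. 1)"
    by (auto simp: coherent_def C_mat_Nil mat_def)
  show ?thesis
    using signed_seq_same_sign_step[OF B _ _ coh a(1)] a that
    by (simp add: reduced_seqs_def B_mat_def)
qed

lemma trop_sign_coherent:
  assumes "coherent (C_mat B w) e"
  shows "trop_sign B w i = e i"
  unfolding trop_sign_def
proof (rule the_equality)
  show "e i \<in> {1, -1} \<and> (\<forall>j. 0 \<le> real_of_int (e i) * column i (C_mat B w) $ j)"
    using assms by (simp add: coherent_def column_def)
next
  fix e' :: int
  assume e': "e' \<in> {1, -1} \<and> (\<forall>j. 0 \<le> real_of_int e' * column i (C_mat B w) $ j)"
  obtain j where "C_mat B w $ j $ i \<noteq> 0"
    using assms unfolding coherent_def by blast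
  moreover have "0 \<le> real_of_int e' * C_mat B w $ j $ i" "0 \<le> real_of_int (e i) * C_mat B w $ j $ i"
    "e i \<in> {1, -1}"
    using e' assms by (auto simp: coherent_def column_def)
  ultimately show "e' = e i"
    using e' by auto
qed

text \<open>The definite descriptions are resolved here. By cyclicity row \<open>k\<close> has
  opposite signs at \<open>s\<close> and \<open>t\<close>, so even if the sign at \<open>t\<close>
  differs from that at \<open>k\<close>, the index \<open>t\<close> fails the sign condition
  selecting \<open>S_seq\<close>.\<close>

lemma signed_seq_indices:
  assumes "cluster_cyclic B" "signed_seq B q w e k s" "k \<noteq> t" "s \<noteq> t"
  shows "E_seq B w = (e, k)" "K_seq w = k" "S_seq B w = s" "T_seq B w = t"
proof -
  have w: "w \<in> reduced_seqs" "w \<noteq> []" "last w = k" "coherent (C_mat B w) e"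
    "dominated q (B_mat B w) (C_mat B w) e k s"
    using assms(2) by (auto simp: signed_seq_def)
  have ts: "trop_sign B w = e"
    using trop_sign_coherent[OF w(4)] by blast
  show K: "K_seq w = k" by (simp add: K_seq_def w(3))
  show "E_seq B w = (e, k)" by (simp add: E_seq_def K ts)
  have cyc: "cyclic_mat (B_mat B w)" using assms(1) w(1) by (simp add: cluster_cyclic_def)
  have ks: "k \<noteq> s" "e s = - e k" "0 < real_of_int (e k) * B_mat B w $ k $ s"
    using w(5) by (auto simp: dominated_def)
  have e: "e i \<in> {1, -1}" for i using w(4) by (auto simp: coherent_def)
  show S: "S_seq B w = s"
    unfolding S_seq_def K ts
  proof (rule the_equality)
    show "s \<noteq> k \<and> real_of_int (e s) * sgn (B_mat B w $ k $ s) = -1 \<and> e k \<noteq> e s"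
      using ks e[of k] by (auto simp: sgn_if)
  next
    fix j assume j: "j \<noteq> k \<and> real_of_int (e j) * sgn (B_mat B w $ k $ j) = -1 \<and> e k \<noteq> e j"
    have "j \<noteq> t"
    proof
      assume "j = t"
      then have "e t = - e k" "real_of_int (e t) * sgn (B_mat B w $ k $ t) = -1"
        using j e[of k] e[of t] by auto
      moreover have "real_of_int (e k) * B_mat B w $ k $ t < 0"
        by (rule cyclic_mat_oriented(3)[OF cyc ks(1) assms(3,4) ks(3)])
      ultimately show False
        using e[of k] by (auto simp: sgn_if split: if_splits)
    qed
    then show "j = s" using three_cases[OF ks(1) assms(3,4), of j] j by auto
  qed
  show "T_seq B w = t"
    unfolding T_seq_def K S
    using three_cases[OF ks(1) assms(3,4)] assms(3,4) by (intro the_equality) auto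
qed

text \<open>The sign at \<open>t\<close> agrees with exactly one of those at \<open>k\<close> and
  \<open>s\<close>, and the orientation lets a same-sign step apply with that index as
  \<open>a\<close>. The remaining index \<open>c\<close> then carries the new sign of
  \<open>t\<close>, as a tuple of \<open>sign_tuples\<close> requires.\<close>

lemma signed_seq_T_step:
  assumes B: "cluster_cyclic B" "skew_weights q B" and w: "signed_seq B q w e k s"
    and t: "k \<noteq> t" "s \<noteq> t"
  shows "\<exists>a c. signed_seq B q (w @ [t]) (\<lambda>j. if j = t then - e j else e j) t a \<and>
    t \<noteq> c \<and> a \<noteq> c \<and> e c = - e t"
proof -
  have w': "w \<in> reduced_seqs" "w \<noteq> []" "last w = k" "coherent (C_mat B w) e"
    "dominated q (B_mat B w) (C_mat B w) e k s"
    using w by (auto simp: signed_seq_def)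
  have cyc: "cyclic_mat (B_mat B w)" using B(1) w'(1) by (simp add: cluster_cyclic_def)
  have ks: "k \<noteq> s" "e s = - e k" "0 < real_of_int (e k) * B_mat B w $ k $ s"
    using w'(5) by (auto simp: dominated_def)
  note or = cyclic_mat_oriented[OF cyc ks(1) t ks(3)]
  have "e t \<in> {1, -1}" "e k \<in> {1, -1}" using w'(4) by (auto simp: coherent_def)
  then consider "e t = e k" | "e t = - e k" by auto
  then show ?thesis
  proof cases
    case 1
    have "signed_seq B q (w @ [t]) (\<lambda>j. if j = t then - e j else e j) t k"
      using 1 or t w' by (intro signed_seq_same_sign_step[OF B]) auto
    then show ?thesis using t ks 1 by (intro exI[of _ k] exI[of _ s]) auto
  next
    case 2
    have "signed_seq B q (w @ [t]) (\<lambda>j. if j = t then - e j else e j) t s"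
      using 2 or t ks w' by (intro signed_seq_same_sign_step[OF B]) auto
    then show ?thesis using t ks 2 by (intro exI[of _ s] exI[of _ k]) auto
  qed
qed

section \<open>Sign tuples and the group action on them\<close>

text \<open>Names the indices \<open>S_tup\<close> and \<open>T_tup\<close> as \<open>s\<close> and
  \<open>t\<close>, so that computations avoid definite descriptions.\<close>

definition sign_type :: "(3 \<Rightarrow> int) \<Rightarrow> 3 \<Rightarrow> 3 \<Rightarrow> 3 \<Rightarrow> bool" where
  "sign_type e k s t \<longleftrightarrow>
    k \<noteq> s \<and> k \<noteq> t \<and> s \<noteq> t \<and> e k \<in> {1, -1} \<and> e s = - e k \<and> e t = e k"

lemma sign_type_sign_tuples:
  assumes "sign_type e k s t"
  shows "(e, k) \<in> sign_tuples" "S_tup (e, k) = s" "T_tup (e, k) = t"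
proof -
  have d: "k \<noteq> s" "k \<noteq> t" "s \<noteq> t" and e: "e k \<in> {1, -1}" "e s = - e k" "e t = e k"
    using assms by (auto simp: sign_type_def)
  have j: "j = k \<or> j = s \<or> j = t" for j
    using three_cases[OF d] .
  have ne: "e s \<noteq> e k" using e by auto
  have "e i \<in> {1, -1}" for i using j[of i] e by auto
  moreover have "\<exists>!j. e j \<noteq> e k"
    using ne j e(3) by metis
  ultimately show "(e, k) \<in> sign_tuples"
    by (simp add: sign_tuples_def)
  show "S_tup (e, k) = s"
    unfolding S_tup_def prod.case using ne j e(3) d by (intro the_equality) metis+
  show "T_tup (e, k) = t"
    unfolding T_tup_def prod.case using ne j e(3) d by (intro the_equality) metis+
qed

lemma sign_tuples_sign_type:
  assumes "E \<in> sign_tuples"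
  obtains e k s t where "E = (e, k)" "sign_type e k s t"
proof -
  obtain e k where E: "E = (e, k)" by (cases E)
  have e: "e j \<in> {1, -1}" and u: "\<exists>!j. e j \<noteq> e k" for j
    using assms by (auto simp: sign_tuples_def E)
  obtain s where s: "e s \<noteq> e k" "\<And>j. e j \<noteq> e k \<Longrightarrow> j = s"
    using u by blast
  have "k \<noteq> s" using s(1) by auto
  moreover obtain t where "k \<noteq> t" "s \<noteq> t" by (rule third_index)
  moreover have "e s = - e k" using e[of s] e[of k] s(1) by auto
  ultimately have "sign_type e k s t"
    unfolding sign_type_def using e[of k] s(2) by metis
  with E that show ?thesis by blast
qed

definition nu_sign :: "nu_elt \<Rightarrow> int" where
  "nu_sign l = (case l of Nu_id \<Rightarrow> 1 | Nu \<Rightarrow> -1)"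

lemma nu_sign_cases: "nu_sign l \<in> {1, -1}"
  by (cases l) (auto simp: nu_sign_def)

lemma nu_sign_eq_iff: "nu_sign l = nu_sign l' \<longleftrightarrow> l = l'"
  by (cases l; cases l') (auto simp: nu_sign_def)

lemma S3_nu_act_eq: "S3_nu_act (e, k) (l, \<sigma>) = (\<lambda>j. nu_sign l * e (\<sigma> j), inv \<sigma> k)"
  by (cases l) (auto simp: S3_nu_act_def perm_act_def nu_sign_def)

text \<open>A global sign does not affect which signs agree, so the three roles are only relabelled
  by \<open>inv \<sigma>\<close>.\<close>

lemma sign_type_S3_nu:
  assumes "sign_type e k s t" "\<sigma> permutes UNIV"
  shows "sign_type (\<lambda>j. nu_sign l * e (\<sigma> j)) (inv \<sigma> k) (inv \<sigma> s) (inv \<sigma> t)"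
  using assms nu_sign_cases[of l]
  by (auto simp: sign_type_def permutes_inverses permutes_inv_eq)

text \<open>The letters permute the three roles: \<open>LS\<close> exchanges \<open>k\<close> and
  \<open>s\<close> and keeps \<open>t\<close>, while \<open>LT\<close> turns the triple
  \<open>k\<close>, \<open>s\<close>, \<open>t\<close> into \<open>t\<close>, \<open>k\<close>,
  \<open>s\<close>.\<close>

lemma sign_type_LS:
  "sign_type e k s t \<Longrightarrow> sign_type (\<lambda>j. if j = k \<or> j = s then - e j else e j) s k t"
  by (auto simp: sign_type_def)

lemma sign_type_LT:
  "sign_type e k s t \<Longrightarrow> sign_type (\<lambda>j. if j = t then - e j else e j) t k s"
  by (auto simp: sign_type_def)

lemma tup_letter_sign_type:
  assumes "sign_type e k s t"
  shows "tup_letter (e, k) LS = (\<lambda>j. if j = k \<or> j = s then - e j else e j, s)"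
    "tup_letter (e, k) LT = (\<lambda>j. if j = t then - e j else e j, t)"
  using sign_type_sign_tuples[OF assms] by simp_all

lemma tup_letter_sign_tuples:
  assumes "E \<in> sign_tuples"
  shows "tup_letter E L \<in> sign_tuples"
proof -
  obtain e k s t where E: "E = (e, k)" and st: "sign_type e k s t"
    using sign_tuples_sign_type[OF assms] .
  show ?thesis
    using sign_type_sign_tuples(1)[OF sign_type_LS[OF st]] sign_type_sign_tuples(1)[OF sign_type_LT[OF st]]
    by (cases L) (simp_all only: E tup_letter_sign_type[OF st])
qed

lemma tup_letter_S3_nu_act:
  assumes "E \<in> sign_tuples" "\<sigma> permutes UNIV"
  shows "tup_letter (S3_nu_act E (l, \<sigma>)) L = S3_nu_act (tup_letter E L) (l, \<sigma>)"
proof -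
  obtain e k s t where E: "E = (e, k)" and st: "sign_type e k s t"
    using sign_tuples_sign_type[OF assms(1)] .
  \<comment> \<open>Turns comparisons with \<open>inv \<sigma> i\<close> into comparisons of
    \<open>\<sigma> j\<close> with \<open>i\<close>, after which both sides are the same function of
    \<open>j\<close>.\<close>
  have eq: "j = inv \<sigma> i \<longleftrightarrow> \<sigma> j = i" for i j
    using permutes_inv_eq[OF assms(2)] by metis
  show ?thesis
    unfolding E S3_nu_act_eq
    by (cases L) (simp_all only: tup_letter_sign_type[OF st] S3_nu_act_eq
      tup_letter_sign_type[OF sign_type_S3_nu[OF st assms(2)]] eq, auto)
qed

lemma tup_act_S3_nu_act:
  assumes "E \<in> sign_tuples" "\<sigma> permutes UNIV"
  shows "tup_act (S3_nu_act E (l, \<sigma>)) X = S3_nu_act (tup_act E X) (l, \<sigma>)"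
  using assms(1)
proof (induction X arbitrary: E)
  case Nil
  then show ?case by (simp add: tup_act_def)
next
  case (Cons L X)
  have "tup_act (S3_nu_act E (l, \<sigma>)) (L # X) = tup_act (S3_nu_act (tup_letter E L) (l, \<sigma>)) X"
    by (simp add: tup_act_def tup_letter_S3_nu_act[OF Cons.prems assms(2)])
  also have "\<dots> = S3_nu_act (tup_act (tup_letter E L) X) (l, \<sigma>)"
    by (rule Cons.IH[OF tup_letter_sign_tuples[OF Cons.prems]])
  finally show ?case by (simp add: tup_act_def)
qed

text \<open>Explains why \<open>\<sigma>\<close> is applied to the appended indices: it sends each
  index to the one with the same role in the original tuple.\<close>

lemma S_T_tup_S3_nu_act:
  assumes "E \<in> sign_tuples" "\<sigma> permutes UNIV"
  shows "\<sigma> (snd (S3_nu_act E (l, \<sigma>))) = snd E"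
    "\<sigma> (S_tup (S3_nu_act E (l, \<sigma>))) = S_tup E"
    "\<sigma> (T_tup (S3_nu_act E (l, \<sigma>))) = T_tup E"
proof -
  obtain e k s t where E: "E = (e, k)" and st: "sign_type e k s t"
    using sign_tuples_sign_type[OF assms(1)] .
  show "\<sigma> (snd (S3_nu_act E (l, \<sigma>))) = snd E"
    "\<sigma> (S_tup (S3_nu_act E (l, \<sigma>))) = S_tup E"
    "\<sigma> (T_tup (S3_nu_act E (l, \<sigma>))) = T_tup E"
    using sign_type_sign_tuples[OF st] sign_type_sign_tuples[OF sign_type_S3_nu[OF st assms(2), of l]]
    by (simp_all add: E S3_nu_act_eq permutes_inverses[OF assms(2)])
qed

text \<open>The permutation has to match the K, S and T indices of the two tuples, which determines
  it; the factor in \<open>nu_elt\<close> is then read off from the signs at the last index.\<close>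

lemma S3_nu_simply_transitive:
  assumes "E \<in> sign_tuples" "E' \<in> sign_tuples"
  shows "\<exists>!\<xi>. \<xi> \<in> S3_nu \<and> E' = S3_nu_act E \<xi>"
proof -
  obtain e k s t where E: "E = (e, k)" and st: "sign_type e k s t"
    using sign_tuples_sign_type[OF assms(1)] .
  obtain e' k' s' t' where E': "E' = (e', k')" and st': "sign_type e' k' s' t'"
    using sign_tuples_sign_type[OF assms(2)] .
  have d: "k \<noteq> s" "k \<noteq> t" "s \<noteq> t" and e: "e k \<in> {1, -1}" "e s = - e k" "e t = e k"
    using st by (auto simp: sign_type_def)
  have d': "k' \<noteq> s'" "k' \<noteq> t'" "s' \<noteq> t'" and e': "e' k' \<in> {1, -1}" "e' s' = - e' k'" "e' t' = e' k'"
    using st' by (auto simp: sign_type_def)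
  define \<sigma> where "\<sigma> j = (if j = k' then k else if j = s' then s else t)" for j
  define l where "l = (if e' k' = e k then Nu_id else Nu)"
  have \<sigma>: "\<sigma> k' = k" "\<sigma> s' = s" "\<sigma> t' = t"
    using d' by (auto simp: \<sigma>_def)
  have "inj \<sigma>"
  proof (rule injI)
    fix x y assume "\<sigma> x = \<sigma> y"
    then show "x = y"
      using three_cases[OF d', of x] three_cases[OF d', of y] d by (auto simp: \<sigma>)
  qed
  then have perm: "\<sigma> permutes UNIV"
    by (intro bij_imp_permutes) (auto simp: bij_betw_def finite_UNIV_inj_surj)
  have "e' j = nu_sign l * e (\<sigma> j)" for j
    using three_cases[OF d', of j] e e' by (auto simp: \<sigma> l_def nu_sign_def)
  moreover have "inv \<sigma> k = k'"
    using permutes_inv_eq[OF perm] \<sigma>(1) by blast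
  ultimately have act: "E' = S3_nu_act E (l, \<sigma>)"
    by (simp add: E E' S3_nu_act_eq fun_eq_iff)
  show ?thesis
  proof (rule ex1I[of _ "(l, \<sigma>)"])
    show "(l, \<sigma>) \<in> S3_nu \<and> E' = S3_nu_act E (l, \<sigma>)"
      using perm act by (simp add: S3_nu_def)
  next
    fix \<xi> assume \<xi>: "\<xi> \<in> S3_nu \<and> E' = S3_nu_act E \<xi>"
    obtain l' \<tau> where lt: "\<xi> = (l', \<tau>)" by (cases \<xi>)
    have perm': "\<tau> permutes UNIV" and act': "E' = S3_nu_act E (l', \<tau>)"
      using \<xi> by (auto simp: lt S3_nu_def)
    have "\<tau> k' = k" "\<tau> s' = s" "\<tau> t' = t"
      using S_T_tup_S3_nu_act[OF assms(1) perm', of l', folded act']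
        sign_type_sign_tuples(2,3)[OF st] sign_type_sign_tuples(2,3)[OF st']
      by (simp_all add: E E')
    then have "\<tau> j = \<sigma> j" for j
      using three_cases[OF d', of j] \<sigma> by auto
    then have "\<tau> = \<sigma>" by blast
    moreover have "nu_sign l' * e (\<tau> k') = nu_sign l * e (\<sigma> k')"
      using act act' by (simp add: E S3_nu_act_eq fun_eq_iff)
    then have "nu_sign l' = nu_sign l"
      using e(1) unfolding \<open>\<tau> = \<sigma>\<close> \<sigma>(1) by auto
    ultimately show "\<xi> = (l, \<sigma>)"
      by (simp add: lt nu_sign_eq_iff)
  qed
qed

section \<open>Branches and the transport of sign tuples along sequences\<close>

lemma seq_act_snoc: "seq_act B w (X @ [L]) = seq_letter B (seq_act B w X) L"
  by (simp add: seq_act_def)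

lemma signed_seq_neq: "signed_seq B q w e k s \<Longrightarrow> k \<noteq> s"
  by (simp add: signed_seq_def dominated_def)

lemma signed_seq_append_index:
  "signed_seq B q w e k s \<Longrightarrow> j \<noteq> k \<Longrightarrow> append_index w j = w @ [j]"
  by (auto simp: signed_seq_def append_index_def)

text \<open>For \<open>[i]\<close> both other signs differ from the one at \<open>i\<close>, so the
  tuple lies outside \<open>sign_tuples\<close>. The first \<open>LT\<close> creates the pattern
  \<open>sign_type\<close> and every later letter keeps it.\<close>

lemma signed_seq_act:
  assumes B: "cluster_cyclic B" "skew_weights q B"
  shows "\<exists>e k s. signed_seq B q (seq_act B [i] X) e k s \<and>
    (LT \<in> set X \<longrightarrow> (\<exists>t. sign_type e k s t))"
proof (induction X rule: rev_induct)
  case Nil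
  obtain a where "signed_seq B q [i] (\<lambda>j. if j = i then - 1 else 1) i a"
    using signed_seq_singleton[OF B] .
  then show ?case by (auto simp: seq_act_def)
next
  case (snoc L X)
  define w where "w = seq_act B [i] X"
  obtain e k s where w: "signed_seq B q w e k s" and
    br: "LT \<in> set X \<Longrightarrow> \<exists>t. sign_type e k s t"
    using snoc unfolding w_def by blast
  obtain t where t: "k \<noteq> t" "s \<noteq> t" by (rule third_index)
  have ks: "k \<noteq> s" using signed_seq_neq[OF w] .
  note ind = signed_seq_indices[OF B(1) w t]
  show ?case
  proof (cases L)
    case LS
    have "seq_act B [i] (X @ [L]) = w @ [s]"
      using signed_seq_append_index[OF w] ks by (simp add: seq_act_snoc LS w_def [symmetric] ind)
    moreover have "LT \<in> set (X @ [L]) \<Longrightarrow> \<exists>t. sign_type (\<lambda>j. if j = k \<or> j = s then - e j else e j) s k t"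
      using br sign_type_LS[of e k s] by (auto simp: LS)
    ultimately show ?thesis
      using signed_seq_opposite_sign_step[OF B w] by metis
  next
    case LT
    have eq: "seq_act B [i] (X @ [L]) = w @ [t]"
      using signed_seq_append_index[OF w] t by (simp add: seq_act_snoc LT w_def [symmetric] ind)
    obtain a c where ac: "signed_seq B q (w @ [t]) (\<lambda>j. if j = t then - e j else e j) t a"
      "t \<noteq> c" "a \<noteq> c" "e c = - e t"
      using signed_seq_T_step[OF B w t] by blast
    define e' where "e' = (\<lambda>j. if j = t then - e j else e j)"
    have "e' t \<in> {1, -1}" "t \<noteq> a" "e' a = - e' t"
      using ac(1) unfolding signed_seq_def coherent_def dominated_def e'_def by blast+
    moreover have "e' c = e' t"
      using ac(2,4) by (simp add: e'_def)
    ultimately have "sign_type e' t a c"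
      unfolding sign_type_def using ac(2,3) by blast
    then show ?thesis
      using ac(1) eq unfolding e'_def by metis
  qed
qed

lemma in_branch_signed_seq:
  assumes "cluster_cyclic B" "skew_weights q B" "in_branch B w"
  obtains e k s t where "signed_seq B q w e k s" "sign_type e k s t"
proof -
  obtain i X where "w = seq_act B [i] X" "LT \<in> set X"
    using assms(3) unfolding in_branch_def by blast
  then show ?thesis
    using signed_seq_act[OF assms(1,2), of i X] that by blast
qed

text \<open>On a branch the indices S and T, defined through \<open>B\<close>, can be recovered from
  the tuple, which thus determines its own evolution.\<close>

lemma in_branch_facts:
  assumes "cluster_cyclic B" "skew_symmetrizable B" "in_branch B w"
  shows "E_seq B w \<in> sign_tuples" "S_seq B w = S_tup (E_seq B w)" "T_seq B w = T_tup (E_seq B w)"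
    "E_seq B (seq_letter B w L) = tup_letter (E_seq B w) L"
    "w \<noteq> []"
proof -
  obtain q where q: "skew_weights q B"
    using skew_symmetrizable_weights[OF assms(2)] .
  obtain e k s t where w: "signed_seq B q w e k s" and st: "sign_type e k s t"
    using in_branch_signed_seq[OF assms(1) q assms(3)] .
  have d: "k \<noteq> s" "k \<noteq> t" "s \<noteq> t"
    using st by (auto simp: sign_type_def)
  note ind = signed_seq_indices[OF assms(1) w d(2,3)]
  note app = signed_seq_append_index[OF w]
  show "E_seq B w \<in> sign_tuples" "S_seq B w = S_tup (E_seq B w)" "T_seq B w = T_tup (E_seq B w)"
    using sign_type_sign_tuples[OF st] by (simp_all add: ind)
  show "w \<noteq> []" using w by (simp add: signed_seq_def)
  show "E_seq B (seq_letter B w L) = tup_letter (E_seq B w) L"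
  proof (cases L)
    case LS
    have "E_seq B (w @ [s]) = (\<lambda>j. if j = k \<or> j = s then - e j else e j, s)"
      using signed_seq_indices(1)[OF assms(1) signed_seq_opposite_sign_step[OF assms(1) q w]] d by blast
    then show ?thesis
      using app[of s] d by (simp only: LS ind seq_letter.simps tup_letter_sign_type[OF st])
  next
    case LT
    obtain a c where "signed_seq B q (w @ [t]) (\<lambda>j. if j = t then - e j else e j) t a" "t \<noteq> c" "a \<noteq> c"
      using signed_seq_T_step[OF assms(1) q w d(2,3)] by blast
    then have "E_seq B (w @ [t]) = (\<lambda>j. if j = t then - e j else e j, t)"
      using signed_seq_indices(1)[OF assms(1)] by blast
    then show ?thesis
      using app[of t] d by (simp only: LT ind seq_letter.simps tup_letter_sign_type[OF st])
  qed
qed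

lemma in_branch_seq_letter:
  assumes "in_branch B w"
  shows "in_branch B (seq_letter B w L)"
proof -
  obtain i X where "w = seq_act B [i] X" "LT \<in> set X"
    using assms unfolding in_branch_def by blast
  then have "seq_letter B w L = seq_act B [i] (X @ [L])" "LT \<in> set (X @ [L])"
    by (simp_all add: seq_act_snoc)
  then show ?thesis unfolding in_branch_def by blast
qed

lemma E_seq_act:
  assumes "cluster_cyclic B" "skew_symmetrizable B" "in_branch B w"
  shows "E_seq B (seq_act B w X) = tup_act (E_seq B w) X"
  using assms(3)
proof (induction X arbitrary: w)
  case Nil
  then show ?case by (simp add: seq_act_def tup_act_def)
next
  case (Cons L X)
  then show ?case
    using in_branch_facts(4)[OF assms(1,2) Cons.prems] in_branch_seq_letter
    by (simp add: seq_act_def tup_act_def)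
qed

text \<open>Appending an index other than the last one acts as a letter, and the same letter at
  \<open>w\<^sub>0\<close> appends the image under \<open>\<sigma>\<close>. Equivariance of single
  letters then carries the induction on \<open>u\<close>.\<close>

lemma E_seq_mult:
  assumes B: "cluster_cyclic B" "skew_symmetrizable B" and \<sigma>: "\<sigma> permutes UNIV"
    and "in_branch B w\<^sub>0" "in_branch B w\<^sub>1"
    and "E_seq B w\<^sub>1 = S3_nu_act (E_seq B w\<^sub>0) (l, \<sigma>)"
    and "u \<in> reduced_seqs" "u = [] \<or> hd u \<noteq> K_seq w\<^sub>1"
  shows "E_seq B (seq_mult w\<^sub>1 u) = S3_nu_act (E_seq B (seq_mult w\<^sub>0 (map \<sigma> u))) (l, \<sigma>)"
  using assms(4-)
proof (induction u arbitrary: w\<^sub>0 w\<^sub>1)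
  case Nil
  then show ?case by (simp add: seq_mult_def)
next
  case (Cons j u)
  note f0 = in_branch_facts[OF B Cons.prems(1)] and f1 = in_branch_facts[OF B Cons.prems(2)]
  obtain e k s t where E1: "E_seq B w\<^sub>1 = (e, k)" and st: "sign_type e k s t"
    using sign_tuples_sign_type[OF f1(1)] .
  have d: "k \<noteq> s" "k \<noteq> t" "s \<noteq> t" using st by (auto simp: sign_type_def)
  have K: "K_seq w\<^sub>1 = k" using E1 by (simp add: E_seq_def)
  have "j = s \<or> j = t"
    using Cons.prems(5) three_cases[OF d, of j] by (auto simp: K)
  then have "\<exists>L. append_index w\<^sub>1 j = seq_letter B w\<^sub>1 L \<and> append_index w\<^sub>0 (\<sigma> j) = seq_letter B w\<^sub>0 L"
  proof
    assume "j = s"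
    then have j: "j = S_seq B w\<^sub>1" using sign_type_sign_tuples[OF st] by (simp add: f1 E1)
    then have "\<sigma> j = S_seq B w\<^sub>0"
      using S_T_tup_S3_nu_act(2)[OF f0(1) \<sigma>] by (simp add: f1(2) f0(2) Cons.prems(3))
    with j have "append_index w\<^sub>1 j = seq_letter B w\<^sub>1 LS \<and> append_index w\<^sub>0 (\<sigma> j) = seq_letter B w\<^sub>0 LS"
      by simp
    then show ?thesis ..
  next
    assume "j = t"
    then have j: "j = T_seq B w\<^sub>1" using sign_type_sign_tuples[OF st] by (simp add: f1 E1)
    then have "\<sigma> j = T_seq B w\<^sub>0"
      using S_T_tup_S3_nu_act(3)[OF f0(1) \<sigma>] by (simp add: f1(3) f0(3) Cons.prems(3))
    with j have "append_index w\<^sub>1 j = seq_letter B w\<^sub>1 LT \<and> append_index w\<^sub>0 (\<sigma> j) = seq_letter B w\<^sub>0 LT"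
      by simp
    then show ?thesis ..
  qed
  then obtain L where L: "append_index w\<^sub>1 j = seq_letter B w\<^sub>1 L"
    "append_index w\<^sub>0 (\<sigma> j) = seq_letter B w\<^sub>0 L" by blast
  \<comment> \<open>So \<open>j\<close> is appended rather than deleted and becomes the last index;
    as \<open>j # u\<close> is reduced, the head condition passes on to \<open>u\<close>.\<close>
  have "j \<noteq> last w\<^sub>1" using Cons.prems(5) by (simp add: K_seq_def)
  then have last: "K_seq (append_index w\<^sub>1 j) = j"
    by (simp add: append_index_def K_seq_def)
  have "E_seq B (seq_mult (seq_letter B w\<^sub>1 L) u) =
      S3_nu_act (E_seq B (seq_mult (seq_letter B w\<^sub>0 L) (map \<sigma> u))) (l, \<sigma>)"
  proof (rule Cons.IH)
    show "E_seq B (seq_letter B w\<^sub>1 L) = S3_nu_act (E_seq B (seq_letter B w\<^sub>0 L)) (l, \<sigma>)"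
      unfolding f0(4) f1(4) Cons.prems(3) by (rule tup_letter_S3_nu_act[OF f0(1) \<sigma>])
    show "u \<in> reduced_seqs" "u = [] \<or> hd u \<noteq> K_seq (seq_letter B w\<^sub>1 L)"
      using Cons.prems(4) last by (auto simp: reduced_seqs_def successively_Cons L)
  qed (simp_all add: in_branch_seq_letter Cons.prems)
  then show ?case
    by (simp add: seq_mult_def L)
qed

theorem theorem6p14:
  "(\<forall>E\<in>sign_tuples. \<forall>\<xi>\<in>S3_nu. \<forall>X.
      tup_act (S3_nu_act E \<xi>) X = S3_nu_act (tup_act E X) \<xi>)
   \<and>
   (\<forall>B :: real^3^3. \<forall>w\<^sub>0\<in>reduced_seqs. \<forall>w\<^sub>1\<in>reduced_seqs.
      skew_symmetrizable B \<and> cluster_cyclic B \<and> in_branch B w\<^sub>0 \<and> in_branch B w\<^sub>1 \<longrightarrow>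
      (\<exists>!\<xi>. \<xi> \<in> S3_nu \<and> E_seq B w\<^sub>1 = S3_nu_act (E_seq B w\<^sub>0) \<xi>) \<and>
      (\<forall>l \<sigma>. (l, \<sigma>) \<in> S3_nu \<and> E_seq B w\<^sub>1 = S3_nu_act (E_seq B w\<^sub>0) (l, \<sigma>) \<longrightarrow>
         (\<forall>X. E_seq B (seq_act B w\<^sub>1 X) = S3_nu_act (E_seq B (seq_act B w\<^sub>0 X)) (l, \<sigma>)) \<and>
         (\<forall>u \<in> reduced_seqs - reduced_seqs_ge [K_seq w\<^sub>1].
            E_seq B (seq_mult w\<^sub>1 u) = S3_nu_act (E_seq B (seq_mult w\<^sub>0 (map \<sigma> u))) (l, \<sigma>))))"
proof (intro conjI allI ballI impI)
  fix E \<xi> X assume "E \<in> sign_tuples" "\<xi> \<in> S3_nu"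
  then show "tup_act (S3_nu_act E \<xi>) X = S3_nu_act (tup_act E X) \<xi>"
    using tup_act_S3_nu_act by (cases \<xi>) (auto simp: S3_nu_def)
next
  fix B w\<^sub>0 w\<^sub>1
  assume "skew_symmetrizable B \<and> cluster_cyclic B \<and> in_branch B w\<^sub>0 \<and> in_branch B w\<^sub>1"
  then show "\<exists>!\<xi>. \<xi> \<in> S3_nu \<and> E_seq B w\<^sub>1 = S3_nu_act (E_seq B w\<^sub>0) \<xi>"
    by (intro S3_nu_simply_transitive in_branch_facts) auto
next
  fix B w\<^sub>0 w\<^sub>1 l \<sigma> X
  assume *: "skew_symmetrizable B \<and> cluster_cyclic B \<and> in_branch B w\<^sub>0 \<and> in_branch B w\<^sub>1"
    and \<xi>: "(l, \<sigma>) \<in> S3_nu \<and> E_seq B w\<^sub>1 = S3_nu_act (E_seq B w\<^sub>0) (l, \<sigma>)"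
  then show "E_seq B (seq_act B w\<^sub>1 X) = S3_nu_act (E_seq B (seq_act B w\<^sub>0 X)) (l, \<sigma>)"
    using tup_act_S3_nu_act in_branch_facts(1) by (simp add: E_seq_act S3_nu_def)
next
  fix B w\<^sub>0 w\<^sub>1 l \<sigma> u
  assume *: "skew_symmetrizable B \<and> cluster_cyclic B \<and> in_branch B w\<^sub>0 \<and> in_branch B w\<^sub>1"
    and \<xi>: "(l, \<sigma>) \<in> S3_nu \<and> E_seq B w\<^sub>1 = S3_nu_act (E_seq B w\<^sub>0) (l, \<sigma>)"
    and u: "u \<in> reduced_seqs - reduced_seqs_ge [K_seq w\<^sub>1]"
  have "u = [] \<or> hd u \<noteq> K_seq w\<^sub>1"
    using u by (cases u) (auto simp: reduced_seqs_ge_def)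
  then show "E_seq B (seq_mult w\<^sub>1 u) = S3_nu_act (E_seq B (seq_mult w\<^sub>0 (map \<sigma> u))) (l, \<sigma>)"
    using * \<xi> u by (intro E_seq_mult) (auto simp: S3_nu_def)
qed

end
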